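(* Consider the partial backorder inventory system with zero lead time ($\tau=0$), patience parameter $p\in[0,1]$, sale price $r$ and holding cost $h$. Let $$s^*=\min\Big\{x:\ \mathbb{P}[D_1\le x]\ \ge\ \frac{(1-p)r}{(1-p)r+h}\Big\},$$ the minimum being over nonnegative integers $x$. Then the base-stock policy with level $s^*$ is optimal, i.e. it maximizes the long-run average profit $\mathcal{C}^{\pi}(r,h;{\bf x})$ over all admissible policies $\pi\in\mathcal{A}$ (for every initial state ${\bf x}$).
   Context: Notation: $x^+=\max\{x,0\}$, $x\wedge y=\min(x,y)$, $a_{[i,k]}=\sum_{j=i}^k a_j$ (equal to $0$ if $i>k$). Partial backorder system with zero lead time. The sale price per unit is $r>0$ and the holding cost per unit per period is $h>0$. Demands $D_1,D_2,\dots$ are i.i.d. nonnegative integer-valued with finite mean $d$. For each period $i$, $\{\xi_{i;\ell}:\ell\ge1\}$ are i.i.d. Bernoulli random variables with mean $p\in[0,1]$; these families are independent over $i$ and independent of the demands. The state at the beginning of period $i$ is $X_i=(I_i,B_{i-1})$ (on-hand inventory, backorders), nonnegative integers with $I_iB_{i-1}=0$. In period $i$ an order quantity $Q_i\in\{0,1,2,\dots\}$ is chosen depending on $X_i$ and arrives immediately; then demand $D_i$ is realized, the unmet demand is $U_i=(B_{i-1}+D_i-I_i-Q_i)^+$, and $I_{i+1}=(I_i+Q_i-B_{i-1}-D_i)^+$; $B_i=\xi_{i;[1,U_i]}$ is backordered and $L_i=U_i-B_i$ is lost. A sequence $\pi=(Q_1,Q_2,\dots)$ of such order quantities is an admissible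 policy; $\mathcal{A}$ is the set of admissible policies. The long-run average profit under $\pi$ from initial state ${\bf x}$ is $$\mathcal{C}^\pi(r,h;{\bf x})=\liminf_{N\to\infty}\frac1N\mathbb{E}\Big[\sum_{i=1}^N \Big(r\cdot\big((I_i+Q_i)\wedge(B_{i-1}+D_i)\big)-h\cdot(I_i+Q_i-B_{i-1}-D_i)^+\Big)\Big|X_1={\bf x}\Big].$$ The base-stock policy with level $s$ orders $Q_i=(s-IP_i)^+$ where $IP_i=I_i-B_{i-1}$. *)

theory Defs
  imports "HOL-Probability.Probability"
begin

text \<open>
  Demands \<open>D i\<close> and patience indicators \<open>\<xi> i l\<close> are used for \<open>i \<ge> 1\<close> and \<open>l \<ge> 1\<close> only.
  The indicators are \<open>0/1\<close>-valued natural numbers, so that a single joint independence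
  statement covers all the variables: it makes the demands independent, the indicators
  independent within and across periods, and the two collections independent of each other.
\<close>

locale partial_backorder = prob_space M
  for M :: "'a measure" +
  fixes D :: "nat \<Rightarrow> 'a \<Rightarrow> nat"
    and \<xi> :: "nat \<Rightarrow> nat \<Rightarrow> 'a \<Rightarrow> nat"
    and p r h :: real
  assumes price_pos: "r > 0"
    and holding_pos: "h > 0"
    and patience_ge_0: "p \<ge> 0"
    and patience_le_1: "p \<le> 1"
    and independent:
      "indep_vars (\<lambda>_. count_space UNIV) (case_sum D (\<lambda>(i, l). \<xi> i l))
         ({1..} <+> {1..} \<times> {1..})"
    and demand_identical:
      "\<And>i. i \<ge> 1 \<Longrightarrow> distr M (count_space UNIV) (D i) = distr M (count_space UNIV) (D 1)"
    and demand_finite_mean: "integrable M (\<lambda>\<omega>. real (D 1 \<omega>))"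
    and patience_bernoulli:
      "\<And>i l. i \<ge> 1 \<Longrightarrow> l \<ge> 1 \<Longrightarrow>
         distr M (count_space UNIV) (\<xi> i l) = measure_pmf (map_pmf of_bool (bernoulli_pmf p))"

text \<open>A state is a pair of on-hand inventory and number of backorders.\<close>

type_synonym state = "nat \<times> nat"

definition valid_state :: "state \<Rightarrow> bool" where
  "valid_state x \<longleftrightarrow> fst x * snd x = 0"

text \<open>
  A policy prescribes in period \<open>i\<close> an order quantity as a function of the current state;
  every such sequence of functions is admissible.
\<close>

type_synonym policy = "nat \<Rightarrow> state \<Rightarrow> nat"

definition base_stock :: "nat \<Rightarrow> policy" where
  "base_stock s i x = (case x of (I, B) \<Rightarrow> nat (int s - (int I - int B)))"

text \<open>
  Below, truncated subtraction on the natural numbers plays the role of the positive part.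
  The arguments of \<open>next_state\<close> are the patience indicators of the period, its demand, the
  order quantity and the state at the beginning of the period.
\<close>

definition next_state :: "(nat \<Rightarrow> nat) \<Rightarrow> nat \<Rightarrow> nat \<Rightarrow> state \<Rightarrow> state" where
  "next_state z dem q x = (case x of (I, B) \<Rightarrow>
     let U = (B + dem) - (I + q) in ((I + q) - (B + dem), \<Sum>l = 1..U. z l))"

definition period_profit :: "real \<Rightarrow> real \<Rightarrow> nat \<Rightarrow> nat \<Rightarrow> state \<Rightarrow> real" where
  "period_profit r h dem q x = (case x of (I, B) \<Rightarrow>
     r * real (min (I + q) (B + dem)) - h * real ((I + q) - (B + dem)))"

text \<open>\<open>end_state \<dots> i\<close> is the state at the end of period \<open>i\<close>, hence at the beginning of
  period \<open>i + 1\<close>; the initial state is the one at the beginning of period 1.\<close>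

primrec end_state ::
  "(nat \<Rightarrow> 'a \<Rightarrow> nat) \<Rightarrow> (nat \<Rightarrow> nat \<Rightarrow> 'a \<Rightarrow> nat) \<Rightarrow> policy \<Rightarrow> state \<Rightarrow> nat \<Rightarrow> 'a \<Rightarrow> state" where
  "end_state D \<xi> \<pi> x 0 \<omega> = x"
| "end_state D \<xi> \<pi> x (Suc n) \<omega> =
     (let X = end_state D \<xi> \<pi> x n \<omega>
      in next_state (\<lambda>l. \<xi> (Suc n) l \<omega>) (D (Suc n) \<omega>) (\<pi> (Suc n) X) X)"

definition state_at ::
  "(nat \<Rightarrow> 'a \<Rightarrow> nat) \<Rightarrow> (nat \<Rightarrow> nat \<Rightarrow> 'a \<Rightarrow> nat) \<Rightarrow> policy \<Rightarrow> state \<Rightarrow> nat \<Rightarrow> 'a \<Rightarrow> state" where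
  "state_at D \<xi> \<pi> x i = end_state D \<xi> \<pi> x (i - 1)"

definition total_profit ::
  "(nat \<Rightarrow> 'a \<Rightarrow> nat) \<Rightarrow> (nat \<Rightarrow> nat \<Rightarrow> 'a \<Rightarrow> nat) \<Rightarrow> real \<Rightarrow> real \<Rightarrow> policy \<Rightarrow> state \<Rightarrow> nat \<Rightarrow> 'a \<Rightarrow> real"
  where
  "total_profit D \<xi> r h \<pi> x N \<omega> =
     (\<Sum>i = 1..N. let X = state_at D \<xi> \<pi> x i \<omega> in period_profit r h (D i \<omega>) (\<pi> i X) X)"

text \<open>
  A policy may order so much that the expected holding cost is infinite, and the Bochner
  integral would then be \<open>0\<close>. The expectation is therefore taken in the extended reals;
  under finite mean demand the positive part always has finite expectation, so
  \<open>\<infinity> - \<infinity>\<close> does not occur for \<open>total_profit\<close>.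
\<close>

definition ext_expectation :: "'a measure \<Rightarrow> ('a \<Rightarrow> real) \<Rightarrow> ereal" where
  "ext_expectation M f =
     enn2ereal (\<integral>\<^sup>+ \<omega>. ennreal (f \<omega>) \<partial>M) - enn2ereal (\<integral>\<^sup>+ \<omega>. ennreal (- f \<omega>) \<partial>M)"

definition average_profit ::
  "'a measure \<Rightarrow> (nat \<Rightarrow> 'a \<Rightarrow> nat) \<Rightarrow> (nat \<Rightarrow> nat \<Rightarrow> 'a \<Rightarrow> nat) \<Rightarrow> real \<Rightarrow> real \<Rightarrow> policy \<Rightarrow> state \<Rightarrow> ereal"
  where
  "average_profit M D \<xi> r h \<pi> x =
     liminf (\<lambda>N. ext_expectation M (total_profit D \<xi> r h \<pi> x N) / ereal (real N))"

definition optimal_policy ::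
  "'a measure \<Rightarrow> (nat \<Rightarrow> 'a \<Rightarrow> nat) \<Rightarrow> (nat \<Rightarrow> nat \<Rightarrow> 'a \<Rightarrow> nat) \<Rightarrow> real \<Rightarrow> real \<Rightarrow> policy \<Rightarrow> bool"
  where
  "optimal_policy M D \<xi> r h \<pi>' \<longleftrightarrow>
     (\<forall>x \<pi>. valid_state x \<longrightarrow> average_profit M D \<xi> r h \<pi> x \<le> average_profit M D \<xi> r h \<pi>' x)"

definition optimal_level :: "'a measure \<Rightarrow> (nat \<Rightarrow> 'a \<Rightarrow> nat) \<Rightarrow> real \<Rightarrow> real \<Rightarrow> real \<Rightarrow> nat" where
  "optimal_level M D p r h =
     (LEAST x. measure M {\<omega> \<in> space M. D 1 \<omega> \<le> x} \<ge> (1 - p) * r / ((1 - p) * r + h))"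

end

theory Submission
  imports Defs
begin

text \<open>
  Since a fraction \<open>p\<close> of each shortage is sold later on, the expected sales up to period \<open>N\<close>
  telescope to total demand plus the initial backlog, minus \<open>1 - p\<close> times the expected shortages,
  minus the final expected backlog. Up to that bounded final term, maximizing profit therefore means
  minimizing the sum of newsvendor costs with underage cost \<open>(1 - p) r\<close> and overage cost \<open>h\<close>,
  each of which is a convex function \<open>G\<close> of the stock level \<open>y\<close> after ordering, minimal at the
  critical-ratio quantile \<open>s\<close>. The base-stock policy attains \<open>y = max s IP\<close>. If \<open>IP > s\<close> it has
  not ordered anything so far, so on the same sample path every other policy has at least the same
  stock level; hence \<open>G\<close> at the base-stock level is minimal pathwise in every period, and no
  convergence to a steady state is needed.
\<close>

section \<open>Measurability of the state, and its representation on the coordinate space\<close>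

text \<open>Conditioning on the countably many values of \<open>f\<close> and \<open>g\<close>
  leaves only constant functions, so \<open>k\<close> may be an arbitrary function.\<close>

lemma measurable_countable_compose2:
  fixes f :: "'a \<Rightarrow> 'b::countable" and g :: "'a \<Rightarrow> 'c::countable"
  assumes "f \<in> measurable N (count_space UNIV)" "g \<in> measurable N (count_space UNIV)"
    and "\<And>y z. k y z \<in> space L"
  shows "(\<lambda>\<omega>. k (f \<omega>) (g \<omega>)) \<in> measurable N L"
  by (rule measurable_compose_countable[OF measurable_compose_countable[OF _ assms(2)] assms(1)])
    (simp add: assms(3))

lemma next_state_measurable:
  assumes "\<And>l. l \<ge> 1 \<Longrightarrow> z l \<in> measurable N (count_space UNIV)"
  shows "(\<lambda>\<omega>. next_state (\<lambda>l. z l \<omega>) d q x) \<in> measurable N (count_space UNIV)"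
proof -
  have "(\<lambda>\<omega>. \<Sum>l = 1..U. z l \<omega>) \<in> measurable N (count_space UNIV)" for U :: nat
  proof (induction U)
    case (Suc U)
    have "(\<lambda>\<omega>. (\<Sum>l = 1..U. z l \<omega>) + z (Suc U) \<omega>) \<in> measurable N (count_space UNIV)"
      by (rule measurable_countable_compose2[OF Suc]) (auto intro: assms)
    then show ?case by simp
  qed simp
  from measurable_compose[OF this, where L="count_space UNIV"] show ?thesis
    by (simp add: next_state_def Let_def split_beta)
qed

text \<open>Only periods up to \<open>n\<close> are assumed measurable and \<open>N\<close> is
  arbitrary, so that this applies both to \<open>M\<close> and to a product space carrying only
  those coordinates.\<close>

lemma end_state_measurable:
  assumes "\<And>i. 1 \<le> i \<Longrightarrow> i \<le> n \<Longrightarrow> D i \<in> measurable N (count_space UNIV)"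
    and "\<And>i l. 1 \<le> i \<Longrightarrow> i \<le> n \<Longrightarrow> 1 \<le> l \<Longrightarrow> \<xi> i l \<in> measurable N (count_space UNIV)"
  shows "end_state D \<xi> \<pi> x n \<in> measurable N (count_space UNIV)"
  using assms
proof (induction n)
  case 0
  have "end_state D \<xi> \<pi> x 0 = (\<lambda>_. x)" by (simp add: fun_eq_iff)
  then show ?case by simp
next
  case (Suc n)
  have "(\<lambda>\<omega>. next_state (\<lambda>l. \<xi> (Suc n) l \<omega>) (D (Suc n) \<omega>)
      (\<pi> (Suc n) (end_state D \<xi> \<pi> x n \<omega>)) (end_state D \<xi> \<pi> x n \<omega>)) \<in> measurable N (count_space UNIV)"
    \<comment> \<open>Two case distinctions over countable types, demand and state, leave only the
      patience indicators random.\<close>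
    by (rule measurable_compose_countable[OF measurable_compose_countable[OF next_state_measurable]])
      (use Suc in auto)
  then show ?case
    by (simp add: Let_def cong: measurable_cong)
qed

text \<open>The coordinates that can influence the first \<open>n\<close> periods. All
  \<open>l \<ge> 1\<close> are included because the shortage is unbounded.\<close>

definition indices_upto :: "nat \<Rightarrow> (nat + nat \<times> nat) set" where
  "indices_upto n = {1..n} <+> {1..n} \<times> {1..}"

text \<open>The state on the canonical space: as a function of the restricted family of coordinates
  it inherits independence from the remaining ones.\<close>

abbreviation coordinate_state :: "policy \<Rightarrow> state \<Rightarrow> nat \<Rightarrow> (nat + nat \<times> nat \<Rightarrow> nat) \<Rightarrow> state" where
  "coordinate_state \<equiv> end_state (\<lambda>i f. f (Inl i)) (\<lambda>i l f. f (Inr (i, l)))"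

text \<open>The recursion reads no coordinate outside \<open>indices_upto n\<close>. A general
  superset \<open>A\<close> is allowed because the patience argument later adds the current demand
  to the block.\<close>

lemma end_state_eq_coordinate_state:
  assumes "indices_upto n \<subseteq> A"
  shows "end_state D \<xi> \<pi> x n \<omega> =
    coordinate_state \<pi> x n (\<lambda>j\<in>A. case_sum D (\<lambda>(i, l). \<xi> i l) j \<omega>)"
  using assms
proof (induction n)
  case (Suc n)
  define u where "u = (\<lambda>j\<in>A. case_sum D (\<lambda>(i, l). \<xi> i l) j \<omega>)"
  have "indices_upto n \<subseteq> indices_upto (Suc n)"
    by (auto simp: indices_upto_def)
  then have eq: "coordinate_state \<pi> x n u = end_state D \<xi> \<pi> x n \<omega>"
    unfolding u_def by (intro Suc.IH[symmetric] subset_trans[OF _ Suc.prems])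
  have "Inl (Suc n) \<in> A" "l \<ge> 1 \<Longrightarrow> Inr (Suc n, l) \<in> A" for l
    by (rule subsetD[OF Suc.prems], auto simp: indices_upto_def)+
  then have "u (Inl (Suc n)) = D (Suc n) \<omega>" "l \<ge> 1 \<Longrightarrow> u (Inr (Suc n, l)) = \<xi> (Suc n) l \<omega>" for l
    by (simp_all add: u_def)
  then show ?case
    unfolding u_def[symmetric] by (simp add: eq Let_def next_state_def split_beta)
qed simp

lemma coordinate_state_measurable:
  assumes "indices_upto n \<subseteq> A"
  shows "coordinate_state \<pi> x n \<in> measurable (PiM A (\<lambda>_. count_space UNIV)) (count_space UNIV)"
proof (rule end_state_measurable)
  show "(\<lambda>f. f (Inl i)) \<in> measurable (PiM A (\<lambda>_. count_space UNIV)) (count_space UNIV)"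
    if "1 \<le> i" "i \<le> n" for i
    using that assms by (intro measurable_component_singleton) (auto simp: indices_upto_def)
  show "(\<lambda>f. f (Inr (i, l))) \<in> measurable (PiM A (\<lambda>_. count_space UNIV)) (count_space UNIV)"
    if "1 \<le> i" "i \<le> n" "1 \<le> l" for i l
    using that assms by (intro measurable_component_singleton) (auto simp: indices_upto_def)
qed

context partial_backorder
begin

section \<open>Independence of past, demand and patience\<close>

lemma demand_measurable [measurable]:
  "i \<ge> 1 \<Longrightarrow> D i \<in> measurable M (count_space UNIV)"
  using independent unfolding indep_vars_def by force

lemma demand_le_event [simp]: "{\<omega> \<in> space M. D 1 \<omega> \<le> k} \<in> events"
proof -
  have "D 1 -` {..k} \<inter> space M \<in> events"
    by (rule measurable_sets[OF demand_measurable]) simp_all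
  also have "D 1 -` {..k} \<inter> space M = {\<omega> \<in> space M. D 1 \<omega> \<le> k}"
    by auto
  finally show ?thesis .
qed

lemma int_demand_le_event [simp]: "{\<omega> \<in> space M. int (D 1 \<omega>) \<le> y} \<in> events"
proof -
  have "D 1 -` {d. int d \<le> y} \<inter> space M \<in> events"
    by (rule measurable_sets[OF demand_measurable]) simp_all
  also have "D 1 -` {d. int d \<le> y} \<inter> space M = {\<omega> \<in> space M. int (D 1 \<omega>) \<le> y}"
    by auto
  finally show ?thesis .
qed

lemma patience_measurable [measurable]:
  "i \<ge> 1 \<Longrightarrow> l \<ge> 1 \<Longrightarrow> \<xi> i l \<in> measurable M (count_space UNIV)"
  using independent unfolding indep_vars_def by force

lemma state_measurable [measurable]:
  "end_state D \<xi> \<pi> x n \<in> measurable M (count_space UNIV)"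
  by (rule end_state_measurable) auto

text \<open>Disjoint blocks of an independent family are independent, so the joint law of the block
  \<open>A\<close> and the coordinate \<open>j\<close> is a product, and Tonelli lets
  \<open>j\<close> be averaged over a separate copy \<open>\<omega>'\<close>.\<close>

lemma nn_integral_indep_coordinate:
  fixes f :: "'b::countable \<Rightarrow> nat \<Rightarrow> ennreal"
  defines "V \<equiv> case_sum D (\<lambda>(i, l). \<xi> i l)"
  assumes F [measurable]: "F \<in> measurable (PiM A (\<lambda>_. count_space UNIV)) (count_space UNIV)"
    and A: "A \<subseteq> {1..} <+> {1..} \<times> {1..}" and j: "j \<in> ({1..} <+> {1..} \<times> {1..}) - A"
  shows "(\<integral>\<^sup>+ \<omega>. f (F (\<lambda>k\<in>A. V k \<omega>)) (V j \<omega>) \<partial>M) =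
    (\<integral>\<^sup>+ \<omega>. (\<integral>\<^sup>+ \<omega>'. f (F (\<lambda>k\<in>A. V k \<omega>)) (V j \<omega>') \<partial>M) \<partial>M)"
proof -
  let ?PA = "PiM A (\<lambda>_. count_space UNIV :: nat measure)"
  let ?Pj = "PiM {j} (\<lambda>_. count_space UNIV :: nat measure)"
  let ?VA = "\<lambda>\<omega>. \<lambda>k\<in>A. V k \<omega>" and ?Vj = "\<lambda>\<omega>. \<lambda>k\<in>{j}. V k \<omega>"
  have "indep_var ?PA ?VA ?Pj ?Vj"
    using A j by (intro indep_var_restrict[OF independent[folded V_def]]) auto
  then have VA [measurable]: "?VA \<in> measurable M ?PA" and Vj [measurable]: "?Vj \<in> measurable M ?Pj"
    and eq: "distr M ?PA ?VA \<Otimes>\<^sub>M distr M ?Pj ?Vj = distr M (?PA \<Otimes>\<^sub>M ?Pj) (\<lambda>\<omega>. (?VA \<omega>, ?Vj \<omega>))"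
    unfolding indep_var_distribution_eq by auto
  interpret Vj: prob_space "distr M ?Pj ?Vj"
    by (rule prob_space_distr) fact
  have [measurable]: "(\<lambda>v. v j) \<in> measurable ?Pj (count_space UNIV)"
    by (rule measurable_component_singleton) simp
  have g [measurable]: "(\<lambda>u. f (F (fst u)) (snd u j)) \<in> borel_measurable (?PA \<Otimes>\<^sub>M ?Pj)"
    by (rule measurable_countable_compose2) (simp_all, measurable)
  have "(\<integral>\<^sup>+ \<omega>. f (F (?VA \<omega>)) (V j \<omega>) \<partial>M) =
      (\<integral>\<^sup>+ u. f (F (fst u)) (snd u j) \<partial>(distr M ?PA ?VA \<Otimes>\<^sub>M distr M ?Pj ?Vj))"
    unfolding eq by (subst nn_integral_distr) auto
  also have "\<dots> = (\<integral>\<^sup>+ u. \<integral>\<^sup>+ v. f (F u) (v j) \<partial>distr M ?Pj ?Vj \<partial>distr M ?PA ?VA)"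
    by (subst Vj.nn_integral_fst[symmetric]) (auto cong: measurable_cong_sets)
  also have "\<dots> = (\<integral>\<^sup>+ \<omega>. (\<integral>\<^sup>+ v. f (F (?VA \<omega>)) (v j) \<partial>distr M ?Pj ?Vj) \<partial>M)"
    using measurable_compose[OF F, of "\<lambda>y. \<integral>\<^sup>+ v. f y (v j) \<partial>distr M ?Pj ?Vj" borel]
    by (intro nn_integral_distr[OF VA]) simp
  also have "\<dots> = (\<integral>\<^sup>+ \<omega>. (\<integral>\<^sup>+ \<omega>'. f (F (?VA \<omega>)) (V j \<omega>') \<partial>M) \<partial>M)"
    by (intro nn_integral_cong, subst nn_integral_distr[OF Vj])
      (auto intro: measurable_compose[where N="count_space UNIV"])
  finally show ?thesis .
qed

text \<open>States before the current demand depend on earlier coordinates only, whichever policy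
  produced them; hence this demand can be averaged with the states frozen.\<close>

lemma nn_integral_states_demand:
  fixes f :: "state \<Rightarrow> state \<Rightarrow> nat \<Rightarrow> ennreal"
  shows "(\<integral>\<^sup>+ \<omega>. f (end_state D \<xi> \<pi> x n \<omega>) (end_state D \<xi> \<pi>' x' n \<omega>) (D (Suc n) \<omega>) \<partial>M) =
    (\<integral>\<^sup>+ \<omega>. (\<integral>\<^sup>+ \<omega>'. f (end_state D \<xi> \<pi> x n \<omega>) (end_state D \<xi> \<pi>' x' n \<omega>) (D (Suc n) \<omega>') \<partial>M) \<partial>M)"
proof -
  let ?A = "indices_upto n"
  let ?F = "\<lambda>u. (coordinate_state \<pi> x n u, coordinate_state \<pi>' x' n u)"
  have F: "?F \<in> measurable (PiM ?A (\<lambda>_. count_space UNIV)) (count_space UNIV)"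
    by (rule measurable_countable_compose2[OF coordinate_state_measurable coordinate_state_measurable])
      simp_all
  have A: "?A \<subseteq> {1..} <+> {1..} \<times> {1..}" and j: "Inl (Suc n) \<in> ({1..} <+> {1..} \<times> {1..}) - ?A"
    by (auto simp: indices_upto_def)
  show ?thesis
    using nn_integral_indep_coordinate[where f="\<lambda>(X, X'). f X X'", OF F A j]
    by (simp add: end_state_eq_coordinate_state[of n ?A D \<xi>])
qed

lemma nn_integral_state_demand_patience:
  fixes f :: "state \<Rightarrow> nat \<Rightarrow> nat \<Rightarrow> ennreal"
  assumes "l \<ge> 1"
  shows "(\<integral>\<^sup>+ \<omega>. f (end_state D \<xi> \<pi> x n \<omega>) (D (Suc n) \<omega>) (\<xi> (Suc n) l \<omega>) \<partial>M) =
    (\<integral>\<^sup>+ \<omega>. (\<integral>\<^sup>+ \<omega>'. f (end_state D \<xi> \<pi> x n \<omega>) (D (Suc n) \<omega>) (\<xi> (Suc n) l \<omega>') \<partial>M) \<partial>M)"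
proof -
  let ?A = "insert (Inl (Suc n)) (indices_upto n)"
  let ?F = "\<lambda>u. (coordinate_state \<pi> x n u, u (Inl (Suc n)))"
  have F: "?F \<in> measurable (PiM ?A (\<lambda>_. count_space UNIV)) (count_space UNIV)"
    by (rule measurable_countable_compose2[OF coordinate_state_measurable measurable_component_singleton])
      auto
  have A: "?A \<subseteq> {1..} <+> {1..} \<times> {1..}"
    and j: "Inr (Suc n, l) \<in> ({1..} <+> {1..} \<times> {1..}) - ?A"
    using assms by (auto simp: indices_upto_def)
  show ?thesis
    using nn_integral_indep_coordinate[where f="\<lambda>(X, d). f X d", OF F A j]
    by (simp add: end_state_eq_coordinate_state[of n ?A D \<xi>] subset_insertI)
qed

lemma nn_integral_demand:
  "(\<integral>\<^sup>+ \<omega>. f (D (Suc n) \<omega>) \<partial>M) = (\<integral>\<^sup>+ \<omega>. f (D 1 \<omega>) \<partial>M)"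
proof -
  have "(\<integral>\<^sup>+ \<omega>. f (D (Suc n) \<omega>) \<partial>M) = (\<integral>\<^sup>+ d. f d \<partial>distr M (count_space UNIV) (D (Suc n)))"
    by (subst nn_integral_distr) auto
  also have "\<dots> = (\<integral>\<^sup>+ d. f d \<partial>distr M (count_space UNIV) (D 1))"
    by (subst demand_identical) auto
  also have "\<dots> = (\<integral>\<^sup>+ \<omega>. f (D 1 \<omega>) \<partial>M)"
    by (subst nn_integral_distr) auto
  finally show ?thesis .
qed

lemma nn_integral_patience:
  assumes "i \<ge> 1" "l \<ge> 1"
  shows "(\<integral>\<^sup>+ \<omega>. ennreal (\<xi> i l \<omega>) \<partial>M) = ennreal p"
proof -
  have "(\<integral>\<^sup>+ \<omega>. ennreal (\<xi> i l \<omega>) \<partial>M) = (\<integral>\<^sup>+ k. ennreal (real k) \<partial>distr M (count_space UNIV) (\<xi> i l))"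
    using assms by (subst nn_integral_distr) auto
  also have "\<dots> = ennreal p"
    using assms patience_ge_0 patience_le_1 by (simp add: patience_bernoulli)
  finally show ?thesis .
qed

section \<open>Shortage, surplus and backlog: dynamics and expectations\<close>

text \<open>The index \<open>n\<close> refers to period \<open>n + 1\<close> in \<open>stock_level\<close>, \<open>shortage\<close> and \<open>surplus\<close>,
  but to the end of period \<open>n\<close> in \<open>backlog\<close>.\<close>

definition stock_level :: "policy \<Rightarrow> nat \<Rightarrow> state \<Rightarrow> int" where
  "stock_level \<pi> n X = int (fst X) - int (snd X) + int (\<pi> (Suc n) X)"

definition shortage :: "policy \<Rightarrow> state \<Rightarrow> nat \<Rightarrow> 'a \<Rightarrow> nat" where
  "shortage \<pi> x n \<omega> = nat (int (D (Suc n) \<omega>) - stock_level \<pi> n (end_state D \<xi> \<pi> x n \<omega>))"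

definition surplus :: "policy \<Rightarrow> state \<Rightarrow> nat \<Rightarrow> 'a \<Rightarrow> nat" where
  "surplus \<pi> x n \<omega> = nat (stock_level \<pi> n (end_state D \<xi> \<pi> x n \<omega>) - int (D (Suc n) \<omega>))"

abbreviation backlog :: "policy \<Rightarrow> state \<Rightarrow> nat \<Rightarrow> 'a \<Rightarrow> nat" where
  "backlog \<pi> x n \<omega> \<equiv> snd (end_state D \<xi> \<pi> x n \<omega>)"

abbreviation mean_demand :: real where
  "mean_demand \<equiv> \<integral>\<omega>. real (D 1 \<omega>) \<partial>M"

text \<open>Both truncated differences are the positive parts of \<open>y - d\<close> and
  \<open>d - y\<close> for the integer stock level \<open>y\<close>, so the old state enters the
  transition only through \<open>y\<close>.\<close>

lemma end_state_Suc:
  "end_state D \<xi> \<pi> x (Suc n) \<omega> =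
    (surplus \<pi> x n \<omega>, \<Sum>l = 1..shortage \<pi> x n \<omega>. \<xi> (Suc n) l \<omega>)"
proof -
  obtain I B where X: "end_state D \<xi> \<pi> x n \<omega> = (I, B)" by fastforce
  let ?q = "\<pi> (Suc n) (I, B)" and ?d = "D (Suc n) \<omega>"
  have "surplus \<pi> x n \<omega> = (I + ?q) - (B + ?d)" "shortage \<pi> x n \<omega> = (B + ?d) - (I + ?q)"
    unfolding surplus_def shortage_def stock_level_def X by auto
  then show ?thesis
    by (simp add: X next_state_def Let_def)
qed

text \<open>Sales are the requested amount minus the shortage. The holding part is kept as a
  separate sum because it alone can have infinite expectation.\<close>

lemma total_profit_eq:
  "total_profit D \<xi> r h \<pi> x N \<omega> =
    (\<Sum>n<N. r * (real (backlog \<pi> x n \<omega>) + real (D (Suc n) \<omega>) - real (shortage \<pi> x n \<omega>)))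
    - (\<Sum>n<N. h * real (surplus \<pi> x n \<omega>))"
proof -
  have "period_profit r h (D (Suc n) \<omega>) (\<pi> (Suc n) (end_state D \<xi> \<pi> x n \<omega>)) (end_state D \<xi> \<pi> x n \<omega>) =
    r * (real (backlog \<pi> x n \<omega>) + real (D (Suc n) \<omega>) - real (shortage \<pi> x n \<omega>))
      - h * real (surplus \<pi> x n \<omega>)" for n
  proof -
    obtain I B where X: "end_state D \<xi> \<pi> x n \<omega> = (I, B)" by fastforce
    let ?q = "\<pi> (Suc n) (I, B)" and ?d = "D (Suc n) \<omega>"
    have 1: "surplus \<pi> x n \<omega> = (I + ?q) - (B + ?d)"
      and 2: "shortage \<pi> x n \<omega> = (B + ?d) - (I + ?q)"
      unfolding surplus_def shortage_def stock_level_def X by auto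
    have "real (min (I + ?q) (B + ?d)) = real B + real ?d - real (shortage \<pi> x n \<omega>)"
      unfolding 2 by (simp add: min_def of_nat_diff)
    then show ?thesis
      unfolding period_profit_def X 1 by simp
  qed
  moreover have "(\<Sum>i = 1..N. f i) = (\<Sum>n<N. f (Suc n))" for f :: "nat \<Rightarrow> real"
    by (simp add: sum.atLeast1_atMost_eq)
  ultimately show ?thesis
    by (simp add: total_profit_def state_at_def Let_def sum_subtractf)
qed

lemma shortage_measurable [measurable]: "shortage \<pi> x n \<in> measurable M (count_space UNIV)"
  unfolding shortage_def[abs_def]
  by (rule measurable_countable_compose2[OF demand_measurable state_measurable]) simp_all

lemma surplus_measurable [measurable]: "surplus \<pi> x n \<in> measurable M (count_space UNIV)"
  unfolding surplus_def[abs_def]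
  by (rule measurable_countable_compose2[OF state_measurable demand_measurable]) simp_all

text \<open>A sum of random length becomes a series over fixed indices, which can be integrated term
  by term.\<close>

lemma ennreal_sum_eq_suminf:
  "ennreal (real (\<Sum>l = 1..U. z l)) = (\<Sum>l. if l < U then ennreal (real (z (Suc l))) else 0)"
proof -
  have "(\<Sum>l. if l < U then ennreal (real (z (Suc l))) else 0) = (\<Sum>l<U. ennreal (real (z (Suc l))))"
    by (subst suminf_finite[of "{..<U}"]) auto
  also have "\<dots> = ennreal (\<Sum>l<U. real (z (Suc l)))"
    by (rule sum_ennreal) simp
  also have "(\<Sum>l<U. real (z (Suc l))) = real (\<Sum>l = 1..U. z l)"
    by (simp add: sum.atLeast1_atMost_eq)
  finally show ?thesis by simp
qed

lemma suminf_of_bool_lessThan: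
  "(\<Sum>l. if l < U then 1 else 0) = ennreal (real U)"
  by (subst suminf_finite[of "{..<U}"]) (auto simp: ennreal_of_nat_eq_real_of_nat)

text \<open>This is a Wald identity: whether \<open>l < shortage\<close> is decided by state and
  demand, independently of the indicator \<open>l + 1\<close>. Working in \<open>ennreal\<close>
  makes it available before integrability is known.\<close>

lemma nn_integral_backlog_Suc:
  "(\<integral>\<^sup>+ \<omega>. ennreal (backlog \<pi> x (Suc n) \<omega>) \<partial>M) =
    ennreal p * (\<integral>\<^sup>+ \<omega>. ennreal (shortage \<pi> x n \<omega>) \<partial>M)"
proof -
  have summand: "(\<integral>\<^sup>+ \<omega>. (if l < shortage \<pi> x n \<omega> then ennreal (real (\<xi> (Suc n) (Suc l) \<omega>)) else 0) \<partial>M) =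
    ennreal p * (\<integral>\<^sup>+ \<omega>. (if l < shortage \<pi> x n \<omega> then 1 else 0) \<partial>M)" for l
  proof -
    have "(\<integral>\<^sup>+ \<omega>. (if l < shortage \<pi> x n \<omega> then ennreal (real (\<xi> (Suc n) (Suc l) \<omega>)) else 0) \<partial>M) =
      (\<integral>\<^sup>+ \<omega>. (\<integral>\<^sup>+ \<omega>'. (if l < shortage \<pi> x n \<omega> then ennreal (real (\<xi> (Suc n) (Suc l) \<omega>')) else 0) \<partial>M) \<partial>M)"
      unfolding shortage_def
      by (rule nn_integral_state_demand_patience[where f="\<lambda>X d z.
            if l < nat (int d - stock_level \<pi> n X) then ennreal (real z) else 0"]) simp
    also have "\<dots> = (\<integral>\<^sup>+ \<omega>. ennreal p * (if l < shortage \<pi> x n \<omega> then 1 else 0) \<partial>M)"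
      by (intro nn_integral_cong) (simp add: nn_integral_patience)
    also have "\<dots> = ennreal p * (\<integral>\<^sup>+ \<omega>. (if l < shortage \<pi> x n \<omega> then 1 else 0) \<partial>M)"
      by (rule nn_integral_cmult) measurable
    finally show ?thesis .
  qed
  have "(\<integral>\<^sup>+ \<omega>. ennreal (backlog \<pi> x (Suc n) \<omega>) \<partial>M) =
    (\<integral>\<^sup>+ \<omega>. (\<Sum>l. if l < shortage \<pi> x n \<omega> then ennreal (real (\<xi> (Suc n) (Suc l) \<omega>)) else 0) \<partial>M)"
    by (simp only: end_state_Suc snd_conv ennreal_sum_eq_suminf)
  also have "\<dots> = (\<Sum>l. ennreal p * (\<integral>\<^sup>+ \<omega>. (if l < shortage \<pi> x n \<omega> then 1 else 0) \<partial>M))"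
    by (subst nn_integral_suminf) (simp_all add: summand)
  also have "\<dots> = ennreal p * (\<integral>\<^sup>+ \<omega>. (\<Sum>l. if l < shortage \<pi> x n \<omega> then 1 else 0) \<partial>M)"
    by (subst nn_integral_suminf) (simp_all add: ennreal_suminf_cmult)
  also have "\<dots> = ennreal p * (\<integral>\<^sup>+ \<omega>. ennreal (shortage \<pi> x n \<omega>) \<partial>M)"
    by (simp only: suminf_of_bool_lessThan)
  finally show ?thesis .
qed

lemma shortage_le: "shortage \<pi> x n \<omega> \<le> backlog \<pi> x n \<omega> + D (Suc n) \<omega>"
  by (simp add: shortage_def stock_level_def)

lemma integrable_demand: "integrable M (\<lambda>\<omega>. real (D (Suc n) \<omega>))"
proof (rule integrableI_nonneg)
  show "(\<integral>\<^sup>+ \<omega>. ennreal (real (D (Suc n) \<omega>)) \<partial>M) < \<infinity>"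
    using demand_finite_mean nn_integral_demand[of "\<lambda>d. ennreal (real d)" n]
    by (simp add: integrable_iff_bounded)
qed auto

lemma integral_demand: "(\<integral>\<omega>. real (D (Suc n) \<omega>) \<partial>M) = mean_demand"
  using nn_integral_demand[of "\<lambda>d. ennreal (real d)" n] by (simp add: integral_eq_nn_integral)

lemma integrable_shortage_if:
  assumes "integrable M (\<lambda>\<omega>. real (backlog \<pi> x n \<omega>))"
  shows "integrable M (\<lambda>\<omega>. real (shortage \<pi> x n \<omega>))"
proof (rule Bochner_Integration.integrable_bound)
  show "integrable M (\<lambda>\<omega>. real (backlog \<pi> x n \<omega>) + real (D (Suc n) \<omega>))"
    using assms integrable_demand by (rule Bochner_Integration.integrable_add)
  show "AE \<omega> in M. norm (real (shortage \<pi> x n \<omega>)) \<le> norm (real (backlog \<pi> x n \<omega>) + real (D (Suc n) \<omega>))"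
    using shortage_le[of \<pi> x n] by (simp flip: of_nat_add)
qed measurable

text \<open>The induction alternates two bounds: a shortage is at most backlog plus demand, and the
  next backlog has \<open>p\<close> times the mean of the shortage.\<close>

lemma integrable_backlog: "integrable M (\<lambda>\<omega>. real (backlog \<pi> x n \<omega>))"
proof (induction n)
  case (Suc n)
  have "(\<integral>\<^sup>+ \<omega>. ennreal (shortage \<pi> x n \<omega>) \<partial>M) < \<infinity>"
    using integrable_shortage_if[OF Suc] by (simp add: integrable_iff_bounded)
  then have "(\<integral>\<^sup>+ \<omega>. ennreal (backlog \<pi> x (Suc n) \<omega>) \<partial>M) < \<infinity>"
    unfolding nn_integral_backlog_Suc by (simp add: ennreal_mult_less_top)
  moreover have "(\<lambda>\<omega>. real (backlog \<pi> x (Suc n) \<omega>)) \<in> borel_measurable M"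
    by (rule measurable_compose[OF state_measurable]) simp
  ultimately show ?case
    by (intro integrableI_nonneg) auto
qed simp

lemmas integrable_shortage = integrable_shortage_if[OF integrable_backlog]

lemma integral_backlog_Suc:
  "(\<integral>\<omega>. real (backlog \<pi> x (Suc n) \<omega>) \<partial>M) = p * (\<integral>\<omega>. real (shortage \<pi> x n \<omega>) \<partial>M)"
proof -
  have "ennreal (\<integral>\<omega>. real (backlog \<pi> x (Suc n) \<omega>) \<partial>M) =
      ennreal (p * (\<integral>\<omega>. real (shortage \<pi> x n \<omega>) \<partial>M))"
    using nn_integral_backlog_Suc[of \<pi> x n] patience_ge_0
    by (simp only: nn_integral_eq_integral[OF integrable_backlog] nn_integral_eq_integral[OF integrable_shortage]
        AE_I2 of_nat_0_le_iff ennreal_mult' simp_thms)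
  then show ?thesis
    using patience_ge_0 by (subst (asm) ennreal_inj) auto
qed

section \<open>The newsvendor cost and its minimizer\<close>

declare One_nat_def [simp del] \<comment> \<open>otherwise \<open>D 1\<close> becomes \<open>D (Suc 0)\<close>\<close>

definition newsvendor_cost :: "int \<Rightarrow> nat \<Rightarrow> real" where
  "newsvendor_cost y d = (1 - p) * r * real (nat (int d - y)) + h * real (nat (y - int d))"

text \<open>The function \<open>G\<close> of the opening comment. Its argument is an integer since
  an order may leave part of the backlog uncovered.\<close>

definition expected_cost :: "int \<Rightarrow> real" where
  "expected_cost y = (\<integral>\<omega>. newsvendor_cost y (D 1 \<omega>) \<partial>M)"

lemma newsvendor_cost_nonneg: "newsvendor_cost y d \<ge> 0"
  using price_pos holding_pos patience_le_1 by (simp add: newsvendor_cost_def)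

lemma integrable_newsvendor_cost: "integrable M (\<lambda>\<omega>. newsvendor_cost y (D 1 \<omega>))"
proof -
  have "integrable M (\<lambda>\<omega>. real (D 1 \<omega>) + real_of_int \<bar>y\<bar>)"
    using demand_finite_mean by simp
  then have "integrable M (\<lambda>\<omega>. real (nat (int (D 1 \<omega>) - y)))"
    "integrable M (\<lambda>\<omega>. real (nat (y - int (D 1 \<omega>))))"
    by (rule Bochner_Integration.integrable_bound; auto)+
  then show ?thesis
    unfolding newsvendor_cost_def by simp
qed

text \<open>One more unit of stock is either left over, costing \<open>h\<close>, or removes one
  unit of shortage, saving \<open>(1 - p) * r\<close>.\<close>

lemma newsvendor_cost_step:
  "newsvendor_cost (y + 1) d - newsvendor_cost y d =
    ((1 - p) * r + h) * of_bool (int d \<le> y) - (1 - p) * r"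
proof (cases "int d \<le> y")
  case True
  then have "nat (int d - y) = 0" "nat (int d - (y + 1)) = 0" "nat (y + 1 - int d) = Suc (nat (y - int d))"
    by auto
  with True show ?thesis by (simp add: newsvendor_cost_def algebra_simps)
next
  case False
  then have "nat (y - int d) = 0" "nat (y + 1 - int d) = 0" "nat (int d - y) = Suc (nat (int d - (y + 1)))"
    by auto
  with False show ?thesis by (simp add: newsvendor_cost_def algebra_simps)
qed

text \<open>Discrete derivative of \<open>G\<close>: its sign is that of the distribution function
  at \<open>y\<close> minus the critical ratio.\<close>

lemma expected_cost_step:
  "expected_cost (y + 1) - expected_cost y =
    ((1 - p) * r + h) * prob {\<omega> \<in> space M. int (D 1 \<omega>) \<le> y} - (1 - p) * r"
proof -
  define A where "A = {\<omega> \<in> space M. int (D 1 \<omega>) \<le> y}"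
  have [simp]: "A \<in> events"
    unfolding A_def by (rule int_demand_le_event)
  have "expected_cost (y + 1) - expected_cost y =
      (\<integral>\<omega>. newsvendor_cost (y + 1) (D 1 \<omega>) - newsvendor_cost y (D 1 \<omega>) \<partial>M)"
    unfolding expected_cost_def by (simp add: integrable_newsvendor_cost)
  also have "\<dots> = (\<integral>\<omega>. ((1 - p) * r + h) * indicator A \<omega> - (1 - p) * r \<partial>M)"
    by (intro Bochner_Integration.integral_cong refl)
      (simp add: newsvendor_cost_step indicator_def A_def)
  also have "\<dots> = ((1 - p) * r + h) * prob A - (1 - p) * r"
    by (subst Bochner_Integration.integral_diff)
      (auto simp: prob_space less_top[symmetric] intro!: integrable_mult_right integrable_real_indicator)
  finally show ?thesis
    unfolding A_def .
qed

abbreviation critical_ratio :: real where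
  "critical_ratio \<equiv> (1 - p) * r / ((1 - p) * r + h)"

abbreviation s_opt :: nat where
  "s_opt \<equiv> optimal_level M D p r h"

lemma denominator_pos: "(1 - p) * r + h > 0"
  using price_pos holding_pos patience_le_1 by (intro add_nonneg_pos) auto

text \<open>The \<open>LEAST\<close> is attained: the distribution function tends to 1, while
  \<open>h > 0\<close> keeps the critical ratio below 1.\<close>

lemma prob_demand_le_s_opt: "prob {\<omega> \<in> space M. D 1 \<omega> \<le> s_opt} \<ge> critical_ratio"
proof -
  have "(\<lambda>n. prob {\<omega> \<in> space M. D 1 \<omega> \<le> n}) \<longlonglongrightarrow> prob (\<Union>n. {\<omega> \<in> space M. D 1 \<omega> \<le> n})"
    by (rule finite_Lim_measure_incseq) (auto simp: incseq_def)
  also have "(\<Union>n. {\<omega> \<in> space M. D 1 \<omega> \<le> n}) = space M"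
    by auto
  finally have "(\<lambda>n. prob {\<omega> \<in> space M. D 1 \<omega> \<le> n}) \<longlonglongrightarrow> 1"
    by (simp add: prob_space)
  moreover have "critical_ratio < 1"
    using denominator_pos holding_pos by simp
  ultimately have "\<forall>\<^sub>F n in sequentially. prob {\<omega> \<in> space M. D 1 \<omega> \<le> n} > critical_ratio"
    by (rule order_tendstoD)
  then obtain n where "prob {\<omega> \<in> space M. D 1 \<omega> \<le> n} > critical_ratio"
    unfolding eventually_sequentially by blast
  then show ?thesis
    unfolding optimal_level_def
    using LeastI[of "\<lambda>k. critical_ratio \<le> prob {\<omega> \<in> space M. D 1 \<omega> \<le> k}" n] by simp
qed

lemma expected_cost_mono_above:
  assumes "int s_opt \<le> y" "y \<le> z"
  shows "expected_cost y \<le> expected_cost z"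
  using assms(2)
proof (induction z rule: int_ge_induct)
  case (step z)
  have "critical_ratio \<le> prob {\<omega> \<in> space M. D 1 \<omega> \<le> s_opt}"
    by (rule prob_demand_le_s_opt)
  also have "\<dots> \<le> prob {\<omega> \<in> space M. int (D 1 \<omega>) \<le> z}"
    using assms step by (intro finite_measure_mono) auto
  finally have "(1 - p) * r \<le> ((1 - p) * r + h) * prob {\<omega> \<in> space M. int (D 1 \<omega>) \<le> z}"
    using denominator_pos by (simp add: pos_divide_le_eq mult.commute)
  with expected_cost_step[of z] step show ?case by linarith
qed simp

text \<open>Minimality of \<open>s_opt\<close> keeps the distribution function at most the critical
  ratio at every lower level, so no increment of \<open>G\<close> up to \<open>s_opt\<close> is
  positive.\<close>

lemma expected_cost_antimono_below:
  assumes "y \<le> int s_opt"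
  shows "expected_cost (int s_opt) \<le> expected_cost y"
  using assms
proof (induction y rule: int_le_induct)
  case (step y)
  \<comment> \<open>The increment from \<open>y - 1\<close> to \<open>y\<close> involves the
    distribution function at \<open>y - 1\<close>. For negative \<open>y - 1\<close> it is 0,
    outside the scope of \<open>LEAST\<close> over the naturals.\<close>
  have "prob {\<omega> \<in> space M. int (D 1 \<omega>) \<le> y - 1} \<le> critical_ratio"
  proof (cases "y - 1 \<ge> 0")
    case True
    have "\<not> critical_ratio \<le> prob {\<omega> \<in> space M. D 1 \<omega> \<le> nat (y - 1)}"
      using step True unfolding optimal_level_def
      using not_less_Least[of "nat (y - 1)" "\<lambda>k. critical_ratio \<le> prob {\<omega> \<in> space M. D 1 \<omega> \<le> k}"]
      by simp
    moreover have "{\<omega> \<in> space M. int (D 1 \<omega>) \<le> y - 1} = {\<omega> \<in> space M. D 1 \<omega> \<le> nat (y - 1)}"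
      using True by auto
    ultimately show ?thesis by simp
  next
    case False
    then have "{\<omega> \<in> space M. int (D 1 \<omega>) \<le> y - 1} = {}" by auto
    then show ?thesis
      using denominator_pos price_pos patience_le_1 by (simp only: measure_empty) simp
  qed
  then have "((1 - p) * r + h) * prob {\<omega> \<in> space M. int (D 1 \<omega>) \<le> y - 1} \<le> (1 - p) * r"
    using denominator_pos by (simp add: pos_le_divide_eq mult.commute)
  with expected_cost_step[of "y - 1"] step show ?case by simp
qed simp

section \<open>Pathwise comparison with the base-stock policy\<close>

abbreviation base_policy :: policy where
  "base_policy \<equiv> base_stock s_opt"

lemma stock_level_base_stock:
  "stock_level (base_stock s) n X = max (int s) (int (fst X) - int (snd X))"
  by (simp add: stock_level_def base_stock_def split: prod.split)

text \<open>A position above \<open>s\<close> after a demand was above \<open>s\<close> before it,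
  so base-stock ordered nothing in that period, whereas \<open>\<pi>\<close> can only add stock.
  Both paths then lose the same demand.\<close>

lemma inventory_position_ge_base_stock:
  assumes "int s < int (fst (end_state D \<xi> (base_stock s) x n \<omega>)) - int (backlog (base_stock s) x n \<omega>)"
  shows "int (fst (end_state D \<xi> (base_stock s) x n \<omega>)) - int (backlog (base_stock s) x n \<omega>)
    \<le> int (fst (end_state D \<xi> \<pi> x n \<omega>)) - int (backlog \<pi> x n \<omega>)"
  using assms
proof (induction n)
  case (Suc n)
  let ?X = "end_state D \<xi> (base_stock s) x n \<omega>" and ?X' = "end_state D \<xi> \<pi> x n \<omega>"
  let ?y = "stock_level (base_stock s) n ?X" and ?y' = "stock_level \<pi> n ?X'"
  \<comment> \<open>Removing the backlog only raises the position, so the surplus alone exceeds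
    \<open>s \<ge> 0\<close> and the truncation by \<open>nat\<close> is inactive.\<close>
  from Suc.prems have less: "int s < ?y - int (D (Suc n) \<omega>)"
    unfolding end_state_Suc fst_conv snd_conv surplus_def by linarith
  then have "int s < int (fst ?X) - int (snd ?X)"
    by (simp add: stock_level_base_stock)
  then have "?y \<le> ?y'"
    using Suc.IH by (simp add: stock_level_base_stock) (simp add: stock_level_def)
  \<comment> \<open>Both levels exceed the demand, so both shortages vanish and no random backorders
    enter either position.\<close>
  with less show ?case
    unfolding end_state_Suc by (simp add: surplus_def shortage_def)
qed simp

lemma expected_cost_base_policy_le:
  "expected_cost (stock_level base_policy n (end_state D \<xi> base_policy x n \<omega>))
    \<le> expected_cost (stock_level \<pi> n (end_state D \<xi> \<pi> x n \<omega>))"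
proof (cases "int s_opt < int (fst (end_state D \<xi> base_policy x n \<omega>)) - int (backlog base_policy x n \<omega>)")
  case True
  from inventory_position_ge_base_stock[OF this, of \<pi>] True show ?thesis
    by (intro expected_cost_mono_above)
      (simp_all add: stock_level_base_stock, simp add: stock_level_def)
next
  case False
  then have "stock_level base_policy n (end_state D \<xi> base_policy x n \<omega>) = int s_opt"
    by (simp add: stock_level_base_stock)
  then show ?thesis
    using expected_cost_mono_above expected_cost_antimono_below by (metis linorder_linear order_refl)
qed

section \<open>Expected period costs and the backlog under base-stock\<close>

definition period_cost :: "policy \<Rightarrow> state \<Rightarrow> nat \<Rightarrow> 'a \<Rightarrow> real" where
  "period_cost \<pi> x n \<omega> = (1 - p) * r * real (shortage \<pi> x n \<omega>) + h * real (surplus \<pi> x n \<omega>)"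

lemma period_cost_nonneg: "period_cost \<pi> x n \<omega> \<ge> 0"
  using price_pos holding_pos patience_le_1 by (simp add: period_cost_def)

text \<open>The stock level is fixed before the demand is seen, so the demand averages out to
  \<open>G\<close>. The identity is in \<open>ennreal\<close> because the holding cost may have
  infinite mean.\<close>

lemma nn_integral_period_cost:
  "(\<integral>\<^sup>+ \<omega>. ennreal (period_cost \<pi> x n \<omega>) \<partial>M) =
    (\<integral>\<^sup>+ \<omega>. ennreal (expected_cost (stock_level \<pi> n (end_state D \<xi> \<pi> x n \<omega>))) \<partial>M)"
proof -
  have inner: "(\<integral>\<^sup>+ \<omega>'. ennreal (newsvendor_cost y (D (Suc n) \<omega>')) \<partial>M) = ennreal (expected_cost y)" for y
    using nn_integral_demand[of "\<lambda>d. ennreal (newsvendor_cost y d)" n]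
    by (simp add: expected_cost_def nn_integral_eq_integral integrable_newsvendor_cost newsvendor_cost_nonneg)
  have "(\<integral>\<^sup>+ \<omega>. ennreal (period_cost \<pi> x n \<omega>) \<partial>M) =
    (\<integral>\<^sup>+ \<omega>. (\<integral>\<^sup>+ \<omega>'. ennreal (newsvendor_cost (stock_level \<pi> n (end_state D \<xi> \<pi> x n \<omega>)) (D (Suc n) \<omega>')) \<partial>M) \<partial>M)"
    unfolding period_cost_def shortage_def surplus_def newsvendor_cost_def[symmetric]
    by (rule nn_integral_states_demand[where f="\<lambda>X X' d. ennreal (newsvendor_cost (stock_level \<pi> n X) d)"])
  also have "\<dots> = (\<integral>\<^sup>+ \<omega>. ennreal (expected_cost (stock_level \<pi> n (end_state D \<xi> \<pi> x n \<omega>))) \<partial>M)"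
    by (simp only: inner)
  finally show ?thesis .
qed

lemma nn_integral_period_cost_base_policy_le:
  "(\<integral>\<^sup>+ \<omega>. ennreal (period_cost base_policy x n \<omega>) \<partial>M) \<le> (\<integral>\<^sup>+ \<omega>. ennreal (period_cost \<pi> x n \<omega>) \<partial>M)"
  unfolding nn_integral_period_cost
  by (intro nn_integral_mono ennreal_leI expected_cost_base_policy_le)

text \<open>The base-stock level is never negative, so a shortage is at most the current demand. The
  index is \<open>Suc n\<close> because the initial backlog is arbitrary.\<close>

lemma integral_backlog_base_stock_le:
  "(\<integral>\<omega>. real (backlog (base_stock s) x (Suc n) \<omega>) \<partial>M) \<le> mean_demand"
proof -
  have "(\<integral>\<omega>. real (shortage (base_stock s) x n \<omega>) \<partial>M) \<le> (\<integral>\<omega>. real (D (Suc n) \<omega>) \<partial>M)"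
    by (rule integral_mono[OF integrable_shortage integrable_demand])
      (simp add: shortage_def stock_level_base_stock)
  moreover have "p * (\<integral>\<omega>. real (shortage (base_stock s) x n \<omega>) \<partial>M)
      \<le> (\<integral>\<omega>. real (shortage (base_stock s) x n \<omega>) \<partial>M)"
    using patience_ge_0 patience_le_1 by (intro mult_left_le_one_le) simp_all
  ultimately show ?thesis
    by (simp only: integral_backlog_Suc integral_demand)
qed

section \<open>Extended expectation of the total profit\<close>

lemma ext_expectation_eq_integral:
  "integrable M f \<Longrightarrow> ext_expectation M f = ereal (\<integral>\<omega>. f \<omega> \<partial>M)"
  by (elim integrableE) (simp add: ext_expectation_def)

text \<open>This covers policies with infinite expected holding cost: the positive part is dominated
  by \<open>\<bar>A\<bar>\<close>, while the negative part is at least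
  \<open>C - \<bar>A\<bar>\<close>.\<close>

lemma ext_expectation_diff_eq_minus_infinity:
  assumes A: "integrable M A" and C [measurable]: "C \<in> borel_measurable M"
    and pos: "\<And>\<omega>. 0 \<le> C \<omega>" and not: "\<not> integrable M C"
  shows "ext_expectation M (\<lambda>\<omega>. A \<omega> - C \<omega>) = -\<infinity>"
proof -
  have [measurable]: "A \<in> borel_measurable M"
    using A by simp
  have A_fin: "(\<integral>\<^sup>+ \<omega>. ennreal \<bar>A \<omega>\<bar> \<partial>M) < \<infinity>"
    using A by (simp add: integrable_iff_bounded)
  have "(\<integral>\<^sup>+ \<omega>. ennreal (A \<omega> - C \<omega>) \<partial>M) \<le> (\<integral>\<^sup>+ \<omega>. ennreal \<bar>A \<omega>\<bar> \<partial>M)"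
    using pos by (intro nn_integral_mono ennreal_leI) (smt (verit))
  with A_fin have plus: "(\<integral>\<^sup>+ \<omega>. ennreal (A \<omega> - C \<omega>) \<partial>M) < \<infinity>"
    by (rule order_le_less_trans[rotated])
  have "\<infinity> = (\<integral>\<^sup>+ \<omega>. ennreal (C \<omega>) \<partial>M)"
    using integrableI_nonneg[OF C] not pos by (metis AE_I2 infinity_ennreal_def top.not_eq_extremum)
  also have "\<dots> \<le> (\<integral>\<^sup>+ \<omega>. ennreal (- (A \<omega> - C \<omega>)) + ennreal \<bar>A \<omega>\<bar> \<partial>M)"
  proof (rule nn_integral_mono)
    fix \<omega>
    \<comment> \<open>\<open>ennreal\<close> sends negative reals to 0; writing \<open>max 0\<close>
      explicitly permits splitting the sum.\<close>
    have "ennreal (C \<omega>) \<le> ennreal (max 0 (- (A \<omega> - C \<omega>)) + \<bar>A \<omega>\<bar>)"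
      by (intro ennreal_leI) simp
    also have "\<dots> = ennreal (- (A \<omega> - C \<omega>)) + ennreal \<bar>A \<omega>\<bar>"
      by (simp add: max_def ennreal_neg)
    finally show "ennreal (C \<omega>) \<le> ennreal (- (A \<omega> - C \<omega>)) + ennreal \<bar>A \<omega>\<bar>" .
  qed
  also have "\<dots> = (\<integral>\<^sup>+ \<omega>. ennreal (- (A \<omega> - C \<omega>)) \<partial>M) + (\<integral>\<^sup>+ \<omega>. ennreal \<bar>A \<omega>\<bar> \<partial>M)"
    by (rule nn_integral_add) measurable
  finally have "(\<integral>\<^sup>+ \<omega>. ennreal (- (A \<omega> - C \<omega>)) \<partial>M) = \<infinity>"
    using A_fin by (auto simp: top_unique)
  with plus show ?thesis
    by (cases "\<integral>\<^sup>+ \<omega>. ennreal (A \<omega> - C \<omega>) \<partial>M") (simp_all add: ext_expectation_def)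
qed

lemma expected_total_profit:
  assumes H: "\<And>n. n < N \<Longrightarrow> integrable M (\<lambda>\<omega>. real (surplus \<pi> x n \<omega>))"
  shows "ext_expectation M (total_profit D \<xi> r h \<pi> x N) =
    ereal (r * real (snd x) + r * real N * mean_demand
      - r * (\<integral>\<omega>. real (backlog \<pi> x N \<omega>) \<partial>M) - (\<Sum>n<N. \<integral>\<omega>. period_cost \<pi> x n \<omega> \<partial>M))"
proof -
  let ?b = "\<lambda>n. \<integral>\<omega>. real (backlog \<pi> x n \<omega>) \<partial>M"
    and ?u = "\<lambda>n. \<integral>\<omega>. real (shortage \<pi> x n \<omega>) \<partial>M"
    and ?g = "\<lambda>n. \<integral>\<omega>. real (surplus \<pi> x n \<omega>) \<partial>M"
  note [simp] = integrable_backlog integrable_shortage integrable_demand integral_demand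
  have "integrable M (total_profit D \<xi> r h \<pi> x N)"
    unfolding total_profit_eq[abs_def] using H
    by (intro Bochner_Integration.integrable_diff Bochner_Integration.integrable_sum) auto
  moreover have "(\<integral>\<omega>. total_profit D \<xi> r h \<pi> x N \<omega> \<partial>M) =
      (\<Sum>n<N. r * (?b n + mean_demand - ?u n)) - (\<Sum>n<N. h * ?g n)"
    unfolding total_profit_eq using H
    by (subst Bochner_Integration.integral_diff)
      (auto simp: Bochner_Integration.integral_sum intro!: Bochner_Integration.integrable_sum)
  moreover have "\<dots> = r * real (snd x) + r * real N * mean_demand - r * ?b N
      - (\<Sum>n<N. (1 - p) * r * ?u n + h * ?g n)"
  \<comment> \<open>With \<open>?b (Suc n) = p * ?u n\<close>, the term
    \<open>r * (?b n - ?u n)\<close> equals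
    \<open>r * (?b n - ?b (Suc n)) - (1 - p) * r * ?u n\<close>, which telescopes from the constant
    initial backlog.\<close>
  proof (induction N)
    case (Suc N)
    then show ?case
      unfolding integral_backlog_Suc by (simp add: algebra_simps)
  qed (simp add: prob_space)
  moreover have "(\<integral>\<omega>. period_cost \<pi> x n \<omega> \<partial>M) = (1 - p) * r * ?u n + h * ?g n" if "n < N" for n
    unfolding period_cost_def using H[OF that] by simp
  ultimately show ?thesis
    by (simp add: ext_expectation_eq_integral)
qed

text \<open>The error is independent of the horizon: it only bounds the final base-stock backlog,
  while the final backlog of \<open>\<pi>\<close> has the favourable sign.\<close>

lemma ext_expectation_total_profit_le:
  "ext_expectation M (total_profit D \<xi> r h \<pi> x (Suc k))
    \<le> ext_expectation M (total_profit D \<xi> r h base_policy x (Suc k)) + ereal (r * mean_demand)"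
proof (cases "integrable M (\<lambda>\<omega>. \<Sum>n<Suc k. h * real (surplus \<pi> x n \<omega>))")
  case False
  then have "ext_expectation M (total_profit D \<xi> r h \<pi> x (Suc k)) = -\<infinity>"
    unfolding total_profit_eq[abs_def] using holding_pos
    by (intro ext_expectation_diff_eq_minus_infinity)
      (auto intro!: sum_nonneg borel_measurable_sum simp del: sum.lessThan_Suc
        simp: integrable_backlog integrable_shortage integrable_demand)
  then show ?thesis by simp
next
  case True
  have H: "integrable M (\<lambda>\<omega>. real (surplus \<pi> x n \<omega>))" if "n < Suc k" for n
  proof -
    have "integrable M (\<lambda>\<omega>. h * real (surplus \<pi> x n \<omega>))"
    proof (rule Bochner_Integration.integrable_bound[OF True])
      have "h * real (surplus \<pi> x n \<omega>) \<le> (\<Sum>n<Suc k. h * real (surplus \<pi> x n \<omega>))" for \<omega>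
        using that holding_pos
        by (intro member_le_sum[where f="\<lambda>n. h * real (surplus \<pi> x n \<omega>)"]) auto
      moreover have "0 \<le> h * real (surplus \<pi> x n \<omega>)" for \<omega>
        using holding_pos by simp
      ultimately show "AE \<omega> in M. norm (h * real (surplus \<pi> x n \<omega>))
          \<le> norm (\<Sum>n<Suc k. h * real (surplus \<pi> x n \<omega>))"
        by (intro AE_I2) (smt (verit) real_norm_def)
    qed measurable
    then show ?thesis using holding_pos by simp
  qed
  have cost: "integrable M (period_cost \<pi> x n)" if "n < Suc k" for n
    unfolding period_cost_def[abs_def] using H[OF that] integrable_shortage by simp
  \<comment> \<open>The comparison of costs in \<open>ennreal\<close> carries finiteness over from
    \<open>\<pi>\<close> to the base-stock policy.\<close>
  have cost_base: "integrable M (period_cost base_policy x n)" if "n < Suc k" for n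
  proof (rule integrableI_nonneg)
    have "(\<integral>\<^sup>+ \<omega>. ennreal (period_cost \<pi> x n \<omega>) \<partial>M) < \<infinity>"
      using cost[OF that] by (simp add: integrable_iff_bounded period_cost_nonneg)
    then show "(\<integral>\<^sup>+ \<omega>. ennreal (period_cost base_policy x n \<omega>) \<partial>M) < \<infinity>"
      using nn_integral_period_cost_base_policy_le by (rule order_le_less_trans[rotated])
    show "period_cost base_policy x n \<in> borel_measurable M"
      unfolding period_cost_def[abs_def] by measurable
  qed (simp add: period_cost_nonneg)
  have H_base: "integrable M (\<lambda>\<omega>. real (surplus base_policy x n \<omega>))" if "n < Suc k" for n
  proof -
    have "integrable M (\<lambda>\<omega>. (period_cost base_policy x n \<omega>
        - (1 - p) * r * real (shortage base_policy x n \<omega>)) / h)"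
      using cost_base[OF that] integrable_shortage by simp
    then show ?thesis using holding_pos by (simp add: period_cost_def)
  qed
  have cost_le: "(\<integral>\<omega>. period_cost base_policy x n \<omega> \<partial>M) \<le> (\<integral>\<omega>. period_cost \<pi> x n \<omega> \<partial>M)"
    if "n < Suc k" for n
    using nn_integral_period_cost_base_policy_le[of x n \<pi>]
    by (simp add: nn_integral_eq_integral cost cost_base that period_cost_nonneg)
  have "(\<Sum>n<Suc k. \<integral>\<omega>. period_cost base_policy x n \<omega> \<partial>M) \<le> (\<Sum>n<Suc k. \<integral>\<omega>. period_cost \<pi> x n \<omega> \<partial>M)"
    by (intro sum_mono cost_le) simp
  moreover have "r * (\<integral>\<omega>. real (backlog base_policy x (Suc k) \<omega>) \<partial>M) \<le> r * mean_demand"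
    using price_pos integral_backlog_base_stock_le by simp
  moreover have "0 \<le> r * (\<integral>\<omega>. real (backlog \<pi> x (Suc k) \<omega>) \<partial>M)"
    using price_pos by simp
  moreover note expected_total_profit[of "Suc k" \<pi> x, OF H]
    expected_total_profit[of "Suc k" base_policy x, OF H_base]
  ultimately show ?thesis
    by (simp del: end_state.simps sum.lessThan_Suc)
qed

section \<open>Passage to the long-run average\<close>

lemma average_profit_le:
  "average_profit M D \<xi> r h \<pi> x \<le> average_profit M D \<xi> r h base_policy x"
proof -
  let ?a = "\<lambda>\<pi> N. ext_expectation M (total_profit D \<xi> r h \<pi> x N) / ereal (real N)"
  have le: "?a \<pi> N \<le> ereal (r * mean_demand / real N) + ?a base_policy N" if N1: "N \<ge> 1" for N
  proof -
    obtain k where N: "N = Suc k" using N1 by (cases N) auto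
    have "?a \<pi> N \<le> (ext_expectation M (total_profit D \<xi> r h base_policy x N) + ereal (r * mean_demand)) / ereal (real N)"
      unfolding N by (intro ereal_divide_right_mono ext_expectation_total_profit_le) simp
    also have "\<dots> = ereal (r * mean_demand / real N) + ?a base_policy N"
      \<comment> \<open>The expectation is an extended real, so dividing the sum termwise is checked
        separately for finite and infinite values.\<close>
      using N1 by (cases "ext_expectation M (total_profit D \<xi> r h base_policy x N)")
        (simp_all add: add_divide_distrib)
    finally show ?thesis .
  qed
  have "(\<lambda>N. r * mean_demand / real N) \<longlonglongrightarrow> 0"
    by (rule lim_const_over_n)
  then have "(\<lambda>N. ereal (r * mean_demand / real N)) \<longlonglongrightarrow> 0"
    by (simp add: zero_ereal_def)
  \<comment> \<open>The error term converges to 0, and a convergent summand with finite limit can be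
    pulled out of a \<open>liminf\<close>.\<close>
  then have "liminf (\<lambda>N. ereal (r * mean_demand / real N) + ?a base_policy N) = 0 + liminf (?a base_policy)"
    by (rule ereal_liminf_lim_add) simp
  moreover have "liminf (?a \<pi>) \<le> liminf (\<lambda>N. ereal (r * mean_demand / real N) + ?a base_policy N)"
    using le by (intro Liminf_mono) (auto simp: eventually_sequentially)
  ultimately show ?thesis
    by (simp add: average_profit_def)
qed

end

theorem theorem1:
  fixes M :: "'a measure"
    and D :: "nat \<Rightarrow> 'a \<Rightarrow> nat"
    and \<xi> :: "nat \<Rightarrow> nat \<Rightarrow> 'a \<Rightarrow> nat"
    and p r h :: real
  assumes "partial_backorder M D \<xi> p r h"
  shows "optimal_policy M D \<xi> r h (base_stock (optimal_level M D p r h))"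
  using partial_backorder.average_profit_le[OF assms] by (simp add: optimal_policy_def)

end
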